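(* Let $(f,X,\mu)$ be a probability measure preserving system on a metric space $X$ satisfying condition (SPDC). Let $\phi\colon X\to[0,\infty)$ be an unbounded function with regular suplevels, with associated exponent $\alpha=\alpha_\phi\in[0,\infty)$, and suppose $\int\phi\,d\mu=\infty$. Let $S_n(x)=\sum_{k=0}^{n-1}\phi(f^k(x))$ and $M_n(x)=\max_{0\le k\le n-1}\phi(f^k(x))$. If $\alpha>0$, then for each $0<\varepsilon<\alpha$ and $\mu$-a.e. $x\in X$ there exists $N\in\mathbb{N}$ such that for all $n\ge N$, $$n^{\frac{1}{\alpha+\varepsilon}}\le M_n(x)<S_n(x)\le n^{\frac{1}{\alpha-\varepsilon}}.$$ If $\alpha=0$, then for $\mu$-a.e. $x\in X$, $$\lim_{n\to\infty}\frac{\log S_n(x)}{\log n}=\lim_{n\to\infty}\frac{\log M_n(x)}{\log n}=\infty.$$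
   Context: Condition (SPDC) (super-polynomial decay of correlations): there is a rate function $\Theta(n)$ with $\lim_{n\to\infty}n^{a}\Theta(n)=0$ for every $a>0$ such that for all Lipschitz functions $\varphi,\psi\colon X\to\mathbb{R}$ in the Banach space of Lipschitz functions and all $n$, $$\Big|\int\varphi\circ f^n\,\psi\,d\mu-\int\varphi\,d\mu\int\psi\,d\mu\Big|\le\|\varphi\|\,\|\psi\|\,\Theta(n),$$ where $\|\cdot\|$ is the usual Lipschitz norm (sup norm plus Lipschitz constant). Regular suplevels: for an unbounded $\phi\colon X\to[0,\infty)$ let $A_n=\{x\in X:\phi(x)\ge n\}$. The function $\phi$ has regular suplevels if: (i) $\lim_{n\to\infty}\mu(A_n)=0$; there is a constant $c>0$ such that $\mu(A_{n+1})>c\,\mu(A_n)$ for all sufficiently large $n$; and there is $\alpha_\phi\in[0,\infty)$ with $\alpha_\phi=\lim_{n\to\infty}\frac{\log\mu(A_n)}{-\log n}$; (ii) there are $\beta\ge0$ and a Lipschitz function $\tilde\phi\colon X\to\mathbb{R}^+$ (nonnegative values) such that $A_n=\{x\in X:\tilde\phi(x)\le(\mu(A_n))^{\beta}\}$. *)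

theory Defs
  imports "HOL-Probability.Probability"
begin

definition measure_preserving_map :: "'a measure \<Rightarrow> ('a \<Rightarrow> 'a) \<Rightarrow> bool" where
  "measure_preserving_map M f \<longleftrightarrow> f \<in> measurable M M \<and> distr M M f = M"

text \<open>The Banach space of Lipschitz functions normed by sup norm plus Lipschitz constant
  consists of the bounded Lipschitz functions.\<close>

definition bounded_lipschitz :: "('a::metric_space \<Rightarrow> real) \<Rightarrow> bool" where
  "bounded_lipschitz g \<longleftrightarrow> bounded (range g) \<and> (\<exists>L. L-lipschitz_on UNIV g)"

definition lipschitz_norm :: "('a::metric_space \<Rightarrow> real) \<Rightarrow> real" where
  "lipschitz_norm g = (SUP x. \<bar>g x\<bar>) + Inf {L. L-lipschitz_on UNIV g}"

definition SPDC :: "'a::metric_space measure \<Rightarrow> ('a \<Rightarrow> 'a) \<Rightarrow> bool" where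
  "SPDC M f \<longleftrightarrow> (\<exists>\<Theta> :: nat \<Rightarrow> real.
     (\<forall>a>0. (\<lambda>n. real n powr a * \<Theta> n) \<longlonglongrightarrow> 0) \<and>
     (\<forall>g h n. bounded_lipschitz g \<longrightarrow> bounded_lipschitz h \<longrightarrow>
        \<bar>(\<integral>x. g ((f ^^ n) x) * h x \<partial>M) - (\<integral>x. g x \<partial>M) * (\<integral>x. h x \<partial>M)\<bar>
          \<le> lipschitz_norm g * lipschitz_norm h * \<Theta> n))"

definition suplevel :: "('a \<Rightarrow> real) \<Rightarrow> nat \<Rightarrow> 'a set" where
  "suplevel \<phi> n = {x. \<phi> x \<ge> real n}"

text \<open>The exponent \<open>\<alpha>\<^sub>\<phi>\<close>; meaningful only if the limit exists, as required below.\<close>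

definition suplevel_exponent :: "'a measure \<Rightarrow> ('a \<Rightarrow> real) \<Rightarrow> real" where
  "suplevel_exponent M \<phi> = lim (\<lambda>n. ln (measure M (suplevel \<phi> n)) / (- ln (real n)))"

text \<open>The second condition of \<open>regular_suplevels\<close> forces all suplevels to have positive measure,
  so neither \<open>ln 0\<close> nor \<open>0 powr 0\<close> occurs. The last condition is imposed for \<open>n \<ge> 1\<close> only; for
  \<open>n = 0\<close> it would say, on a probability space, that the Lipschitz function is at most 1.\<close>

definition regular_suplevels :: "'a::metric_space measure \<Rightarrow> ('a \<Rightarrow> real) \<Rightarrow> bool" where
  "regular_suplevels M \<phi> \<longleftrightarrow>
     (\<lambda>n. measure M (suplevel \<phi> n)) \<longlonglongrightarrow> 0 \<and>
     (\<exists>c>0. \<forall>\<^sub>F n in sequentially.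
        measure M (suplevel \<phi> (n + 1)) > c * measure M (suplevel \<phi> n)) \<and>
     (\<exists>\<alpha>\<ge>0. (\<lambda>n. ln (measure M (suplevel \<phi> n)) / (- ln (real n))) \<longlonglongrightarrow> \<alpha>) \<and>
     (\<exists>\<beta>\<ge>0. \<exists>\<psi> :: 'a \<Rightarrow> real.
        (\<exists>L. L-lipschitz_on UNIV \<psi>) \<and> (\<forall>x. \<psi> x \<ge> 0) \<and>
        (\<forall>n\<ge>1. suplevel \<phi> n = {x. \<psi> x \<le> measure M (suplevel \<phi> n) powr \<beta>}))"

definition birkhoff_sum :: "('a \<Rightarrow> 'a) \<Rightarrow> ('a \<Rightarrow> real) \<Rightarrow> nat \<Rightarrow> 'a \<Rightarrow> real" where
  "birkhoff_sum f \<phi> n x = (\<Sum>k<n. \<phi> ((f ^^ k) x))"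

text \<open>Unspecified for \<open>n = 0\<close>, where the maximum ranges over the empty set.\<close>

definition birkhoff_max :: "('a \<Rightarrow> 'a) \<Rightarrow> ('a \<Rightarrow> real) \<Rightarrow> nat \<Rightarrow> 'a \<Rightarrow> real" where
  "birkhoff_max f \<phi> n x = Max ((\<lambda>k. \<phi> ((f ^^ k) x)) ` {..<n})"

end

theory Submission imports Defs "HOL-Real_Asymp.Real_Asymp"
begin

text \<open>Write \<open>S\<^sub>n\<close> and \<open>M\<^sub>n\<close> for the Birkhoff sums and maxima, \<open>A\<^sub>m\<close> for the suplevels of \<open>\<phi>\<close> and
  \<open>\<mu>\<close> for the measure, so that \<open>\<mu>(A\<^sub>m) = m\<^sup>-\<^sup>\<alpha>\<close> up to factors
  \<open>m\<^sup>\<delta>\<close> with \<open>\<delta>\<close> arbitrarily small.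

  Lower bound. The maximum up to time \<open>n\<close> is at least \<open>m\<close> iff the orbit visits \<open>A\<^sub>m\<close> before
  time \<open>n\<close>. As \<open>A\<^sub>m\<close> is a sublevel set of a Lipschitz function, a Lipschitz cutoff \<open>g\<close> fits
  between the indicators of \<open>A\<^sub>m\<^sub>'\<close> and \<open>A\<^sub>m\<close>, where \<open>m'\<close> is the first index at which the measure
  has halved. An orbit that misses \<open>A\<^sub>m\<close> has vanishing Birkhoff sum of \<open>g\<close>, an event that Chebyshev's inequality controls through the
  autocovariances of \<open>g\<close>. Decay of correlations bounds these by a power of \<open>1/\<mu>(A\<^sub>m)\<close>
  (the Lipschitz constant of \<open>g\<close>) times an arbitrarily high negative power of the time lag, and
  they are trivially at most \<open>\<mu>(A\<^sub>m)\<close>. Interpolating geometrically between the two bounds costs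
  only an arbitrarily small power of \<open>\<mu>(A\<^sub>m)\<close>, so no visit to \<open>A\<^sub>m\<close> before time \<open>n\<close> has
  probability at most \<open>C / (n \<mu>(A\<^sub>m)\<^sup>1\<^sup>+\<^sup>\<eta>)\<close> (lemma \<open>prob_no_visit_suplevel_le\<close>). Along
  \<open>n = 2\<^sup>j\<close>, with \<open>m\<close> close to \<open>n\<^sup>1\<^sup>/\<^sup>\<gamma>\<close> for some \<open>\<gamma> > \<alpha>\<close>, these
  probabilities are summable, and Borel--Cantelli gives \<open>M\<^sub>n \<ge> n\<^sup>1\<^sup>/\<^sup>\<gamma>\<close> for all large \<open>n\<close>.
  For \<open>\<alpha> = 0\<close> every \<open>\<gamma> > 0\<close> is allowed, whence the infinite limits
  for \<open>M\<^sub>n\<close> and thus for \<open>S\<^sub>n \<ge> M\<^sub>n\<close>.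

  Upper bound. The moment of \<open>\<phi>\<close> of order \<open>p\<close> is finite for \<open>p < \<alpha>\<close>. Since \<open>\<phi>\<close> has infinite
  mean, this forces \<open>\<alpha> \<le> 1\<close>, so \<open>t \<mapsto> t\<^sup>p\<close> is subadditive for these \<open>p\<close>, and
  \<open>S\<^sub>n\<^sup>p\<close> is bounded by the Birkhoff sum of \<open>\<phi>\<^sup>p\<close>, whose mean is linear in \<open>n\<close>. Markov's inequality
  and Borel--Cantelli along powers of two give \<open>S\<^sub>n \<le> n\<^sup>1\<^sup>/\<^sup>t\<close> for every positive \<open>t < \<alpha>\<close>.

  The strict inequality between maximum and sum holds because the maximum grows without bound,
  so that at least two terms of the sum are eventually positive.\<close>

section \<open>Second moments of Birkhoff sums\<close>

locale measure_preserving_system = prob_space M for M :: "'a measure" +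
  fixes f :: "'a \<Rightarrow> 'a"
  assumes preserving: "measure_preserving_map M f"
begin

lemma measurable_funpow [measurable]: "(f ^^ k) \<in> measurable M M"
proof (induction k)
  case (Suc k)
  then show ?case
    using preserving unfolding measure_preserving_map_def by (auto intro: measurable_comp)
qed (simp add: id_def)

lemma distr_funpow: "distr M M (f ^^ k) = M"
proof (induction k)
  case 0
  then show ?case by (simp add: id_def distr_id)
next
  case (Suc k)
  have f: "f \<in> measurable M M" "distr M M f = M"
    using preserving unfolding measure_preserving_map_def by auto
  have "distr M M (f ^^ Suc k) = distr (distr M M (f ^^ k)) M f"
    using f(1) by (simp add: distr_distr comp_def)
  then show ?case using Suc f(2) by (simp add: comp_def)
qed

lemma integral_funpow:
  fixes h :: "'a \<Rightarrow> real"
  assumes "h \<in> borel_measurable M"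
  shows "(\<integral>x. h ((f ^^ k) x) \<partial>M) = (\<integral>x. h x \<partial>M)"
  using integral_distr[of "f ^^ k" M M h] assms by (simp add: distr_funpow)

text \<open>By invariance of the measure the covariance of the terms \<open>i\<close> and \<open>j\<close> depends only on
  \<open>\<bar>i - j\<bar>\<close>; summing its bound over \<open>j\<close> meets every lag at most twice, which explains the
  factor 2.\<close>
lemma variance_of_sum_le:
  fixes g :: "'a \<Rightarrow> real" and b :: "nat \<Rightarrow> real"
  assumes g[measurable]: "g \<in> borel_measurable M" and g01: "\<And>x. 0 \<le> g x \<and> g x \<le> 1"
    and cov: "\<And>k. (\<integral>x. g ((f ^^ k) x) * g x \<partial>M) - (\<integral>x. g x \<partial>M)\<^sup>2 \<le> b k"
    and b0: "\<And>k. 0 \<le> b k" and b: "summable b"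
  shows "(\<integral>x. ((\<Sum>k<n. g ((f ^^ k) x)) - real n * (\<integral>x. g x \<partial>M))\<^sup>2 \<partial>M)
           \<le> real n * (2 * suminf b)"
proof -
  define p where "p = (\<integral>x. g x \<partial>M)"
  define h where "h i x = g ((f ^^ i) x) - p" for i x
  define d :: "nat \<Rightarrow> nat \<Rightarrow> real" where "d i j = b (if i \<le> j then j - i else i - j)" for i j
  have [measurable]: "h i \<in> borel_measurable M" for i
    unfolding h_def[abs_def] by measurable
  have bg: "\<bar>g x\<bar> \<le> 1" for x using g01[of x] by auto
  have ig: "integrable M (\<lambda>x. g ((f ^^ i) x))" for i
    by (rule integrable_const_bound[where B=1]) (auto simp: bg)
  have igg: "integrable M (\<lambda>x. g ((f ^^ i) x) * g x)" for i
    by (rule integrable_const_bound[where B=1]) (auto simp: bg abs_mult mult_le_one)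
  have p01: "0 \<le> p" "p \<le> 1"
  proof -
    show "0 \<le> p" unfolding p_def by (rule Bochner_Integration.integral_nonneg) (use g01 in auto)
    have "p \<le> (\<integral>x. 1 \<partial>M)" unfolding p_def
      by (rule integral_mono) (use ig[of 0] g01 in auto)
    then show "p \<le> 1" by (simp add: prob_space)
  qed
  have bh: "\<bar>h i x\<bar> \<le> 1" for i x using g01[of "(f ^^ i) x"] p01 by (auto simp: h_def)
  have ihh: "integrable M (\<lambda>x. h i x * h j x)" for i j
    by (rule integrable_const_bound[where B=1]) (auto simp: bh abs_mult mult_le_one)
  have base: "(\<integral>x. h k x * h 0 x \<partial>M) \<le> b k" for k
  proof -
    have "(\<integral>x. h k x * h 0 x \<partial>M)
        = (\<integral>x. g ((f ^^ k) x) * g x - p * g ((f ^^ k) x) - p * g x + p\<^sup>2 \<partial>M)"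
      by (rule Bochner_Integration.integral_cong) (auto simp: h_def algebra_simps power2_eq_square)
    also have "\<dots> = (\<integral>x. g ((f ^^ k) x) * g x \<partial>M) - p * p - p * p + p\<^sup>2"
      using ig[of k] ig[of 0] igg[of k] integral_funpow[OF g, of k]
      by (simp add: p_def[symmetric] prob_space)
    finally show ?thesis using cov[of k] by (simp add: p_def power2_eq_square)
  qed
  have ordered: "(\<integral>x. h i x * h j x \<partial>M) \<le> b (j - i)" if "i \<le> j" for i j
  proof -
    have "h j x = h (j - i) ((f ^^ i) x)" for x
    proof -
      have "(f ^^ j) x = (f ^^ (j - i)) ((f ^^ i) x)"
        using that funpow_add[of "j - i" i f] by simp
      then show ?thesis by (simp add: h_def)
    qed
    then have "(\<integral>x. h i x * h j x \<partial>M)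
        = (\<integral>x. (\<lambda>y. h (j - i) y * h 0 y) ((f ^^ i) x) \<partial>M)"
      by (simp add: h_def mult.commute)
    also have "\<dots> = (\<integral>x. h (j - i) x * h 0 x \<partial>M)"
      by (rule integral_funpow) measurable
    finally show ?thesis using base by simp
  qed
  have hd: "(\<integral>x. h i x * h j x \<partial>M) \<le> d i j" for i j
    using ordered[of i j] ordered[of j i] by (auto simp: d_def mult.commute)
  have row: "(\<Sum>j<n. d i j) \<le> 2 * suminf b" if "i < n" for i
  proof -
    have "(\<Sum>j<n. d i j) = (\<Sum>j<i. d i j) + (\<Sum>j\<in>{i..<n}. d i j)"
      using that by (subst sum.union_disjoint[symmetric]) (auto intro!: sum.cong)
    also have "(\<Sum>j<i. d i j) = (\<Sum>j<i. b (i - j))"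
      by (rule sum.cong) (auto simp: d_def)
    also have "\<dots> = sum b ((\<lambda>j. i - j) ` {..<i})"
      by (subst sum.reindex) (auto simp: inj_on_def)
    also have "\<dots> \<le> suminf b"
      by (rule sum_le_suminf[OF b]) (auto simp: b0)
    also have "(\<Sum>j\<in>{i..<n}. d i j) = (\<Sum>j\<in>{i..<n}. b (j - i))"
      by (rule sum.cong) (auto simp: d_def)
    also have "\<dots> = sum b ((\<lambda>j. j - i) ` {i..<n})"
      by (subst sum.reindex) (auto simp: inj_on_def)
    also have "\<dots> \<le> suminf b"
      by (rule sum_le_suminf[OF b]) (auto simp: b0)
    finally show ?thesis by simp
  qed
  have "(\<integral>x. ((\<Sum>k<n. g ((f ^^ k) x)) - real n * p)\<^sup>2 \<partial>M)
      = (\<integral>x. (\<Sum>i<n. \<Sum>j<n. h i x * h j x) \<partial>M)"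
    by (rule Bochner_Integration.integral_cong)
       (auto simp: h_def power2_eq_square sum_product[symmetric] sum_subtractf)
  also have "\<dots> = (\<Sum>i<n. \<Sum>j<n. (\<integral>x. h i x * h j x \<partial>M))"
    using ihh by (simp add: Bochner_Integration.integral_sum Bochner_Integration.integrable_sum)
  also have "\<dots> \<le> (\<Sum>i<n. \<Sum>j<n. d i j)"
    by (intro sum_mono hd)
  also have "\<dots> \<le> (\<Sum>i<n. 2 * suminf b)"
    by (intro sum_mono row) auto
  finally show ?thesis by (simp add: p_def)
qed

text \<open>An orbit avoiding the support of \<open>g\<close> has Birkhoff sum \<open>0\<close>, at distance \<open>n \<integral>g\<close> from the mean,
  so this is Chebyshev's inequality.\<close>
lemma prob_no_visit_le:
  fixes g :: "'a \<Rightarrow> real" and b :: "nat \<Rightarrow> real"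
  assumes g[measurable]: "g \<in> borel_measurable M" and g01: "\<And>x. 0 \<le> g x \<and> g x \<le> 1"
    and cov: "\<And>k. (\<integral>x. g ((f ^^ k) x) * g x \<partial>M) - (\<integral>x. g x \<partial>M)\<^sup>2 \<le> b k"
    and b0: "\<And>k. 0 \<le> b k" and b: "summable b"
    and supp: "\<And>x. x \<notin> A \<Longrightarrow> g x = 0" and pos: "0 < (\<integral>x. g x \<partial>M)" and n: "0 < n"
  shows "prob {x \<in> space M. \<forall>k<n. (f ^^ k) x \<notin> A}
           \<le> 2 * suminf b / (real n * (\<integral>x. g x \<partial>M)\<^sup>2)"
proof -
  define p where "p = (\<integral>x. g x \<partial>M)"
  define Y where "Y x = ((\<Sum>k<n. g ((f ^^ k) x)) - real n * p)\<^sup>2" for x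
  have [measurable]: "Y \<in> borel_measurable M" unfolding Y_def[abs_def] by measurable
  have p: "0 < p" using pos by (simp add: p_def)
  have "integrable M Y"
  proof (rule integrable_const_bound[where B="(real n + real n * p)\<^sup>2"])
    have "norm (Y x) \<le> (real n + real n * p)\<^sup>2" for x
    proof -
      have "0 \<le> (\<Sum>k<n. g ((f ^^ k) x))" by (rule sum_nonneg) (use g01 in auto)
      moreover have "(\<Sum>k<n. g ((f ^^ k) x)) \<le> real n"
        using sum_mono[of "{..<n}" "\<lambda>k. g ((f ^^ k) x)" "\<lambda>k. 1"] g01 by simp
      moreover have "0 \<le> real n * p" using p by simp
      ultimately have "\<bar>(\<Sum>k<n. g ((f ^^ k) x)) - real n * p\<bar> \<le> real n + real n * p"
        by linarith
      then show ?thesis unfolding Y_def by (simp add: abs_le_square_iff[symmetric])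
    qed
    then show "AE x in M. norm (Y x) \<le> (real n + real n * p)\<^sup>2" by simp
  qed measurable
  have np: "0 < (real n * p)\<^sup>2" using p n by simp
  have "prob {x \<in> space M. \<forall>k<n. (f ^^ k) x \<notin> A} \<le> prob {x \<in> space M. Y x \<ge> (real n * p)\<^sup>2}"
    by (rule finite_measure_mono) (auto simp: Y_def supp)
  also have "\<dots> \<le> (\<integral>x. Y x \<partial>M) / (real n * p)\<^sup>2"
    by (rule integral_Markov_inequality_measure[where A="{}"])
       (use \<open>integrable M Y\<close> np in \<open>simp_all, simp add: Y_def\<close>)
  also have "\<dots> \<le> (real n * (2 * suminf b)) / (real n * p)\<^sup>2"
    unfolding Y_def p_def
    by (intro divide_right_mono variance_of_sum_le g g01 cov b0 b) auto
  also have "\<dots> = 2 * suminf b / (real n * p\<^sup>2)"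
    using n by (simp add: power2_eq_square)
  finally show ?thesis by (simp add: p_def)
qed

end

section \<open>Decay of correlations for Lipschitz functions\<close>

lemma lipschitz_norm_le:
  assumes K: "K-lipschitz_on UNIV g" and g: "\<And>x. 0 \<le> g x \<and> g x \<le> 1"
  shows "bounded_lipschitz g" "0 \<le> lipschitz_norm g" "lipschitz_norm g \<le> 1 + K"
proof -
  have ag: "\<bar>g x\<bar> \<le> 1" for x using g[of x] by simp
  have bdd: "bdd_above (range (\<lambda>x. \<bar>g x\<bar>))"
    by (rule bdd_aboveI[where M=1]) (auto simp: ag)
  have "bounded (range g)"
    by (rule boundedI[where B=1]) (auto simp: ag)
  then show "bounded_lipschitz g" using K by (auto simp: bounded_lipschitz_def)
  have "0 \<le> \<bar>g undefined\<bar>" by simp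
  also have "\<dots> \<le> (SUP x. \<bar>g x\<bar>)" by (rule cSUP_upper[OF _ bdd]) simp
  finally have "0 \<le> (SUP x. \<bar>g x\<bar>)" .
  moreover have "(SUP x. \<bar>g x\<bar>) \<le> 1"
    by (rule cSUP_least) (auto simp: ag)
  moreover have "0 \<le> Inf {L. L-lipschitz_on UNIV g}"
    using K lipschitz_on_nonneg by (intro cInf_greatest) blast+
  moreover have "Inf {L. L-lipschitz_on UNIV g} \<le> K"
    using K lipschitz_on_nonneg by (intro cInf_lower bdd_belowI[where m=0]) blast+
  ultimately show "0 \<le> lipschitz_norm g" "lipschitz_norm g \<le> 1 + K"
    by (auto simp: lipschitz_norm_def)
qed

text \<open>The consequence of the correlation decay that is used: one polynomial rate, with explicit
  dependence on the Lipschitz constant \<open>K\<close>. The shift from \<open>k\<close> to \<open>Suc k\<close> keeps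
  the bound true at lag 0, where \<open>0 powr - a\<close> would be 0.\<close>
lemma SPDC_polynomial_decay:
  assumes "SPDC M f" and a: "0 < a"
  obtains C where "0 < C"
    and "\<forall>g K k. K-lipschitz_on UNIV g \<longrightarrow> (\<forall>x. 0 \<le> g x \<and> g x \<le> 1) \<longrightarrow>
           (\<integral>x. g ((f ^^ k) x) * g x \<partial>M) - (\<integral>x. g x \<partial>M)\<^sup>2
             \<le> (1 + K)\<^sup>2 * C * real (Suc k) powr - a"
proof -
  obtain \<Theta> :: "nat \<Rightarrow> real" where \<Theta>: "(\<lambda>n. real n powr a * \<Theta> n) \<longlonglongrightarrow> 0"
    and dec: "\<forall>g h n. bounded_lipschitz g \<longrightarrow> bounded_lipschitz h \<longrightarrow>
        \<bar>(\<integral>x. g ((f ^^ n) x) * h x \<partial>M) - (\<integral>x. g x \<partial>M) * (\<integral>x. h x \<partial>M)\<bar>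
          \<le> lipschitz_norm g * lipschitz_norm h * \<Theta> n"
    using assms unfolding SPDC_def by (elim exE conjE) (erule allE[of _ a], erule impE, assumption, blast)
  have "Bseq (\<lambda>n. real n powr a * \<Theta> n)"
    using \<Theta> by (intro convergent_imp_Bseq convergentI)
  then obtain B where B: "0 < B" "\<And>n. \<bar>real n powr a * \<Theta> n\<bar> \<le> B"
    by (auto elim: BseqE)
  define C where "C = B * 2 powr a + \<bar>\<Theta> 0\<bar>"
  have C: "0 < C" using B unfolding C_def by (intro add_pos_nonneg) auto
  have bound: "\<bar>\<Theta> k\<bar> \<le> C * real (Suc k) powr - a" for k
  proof (cases "k = 0")
    case True
    then show ?thesis using B by (simp add: C_def)
  next
    case False
    then have "real (Suc k) powr a \<le> (2 * real k) powr a"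
      using a by (intro powr_mono2) auto
    then have "real (Suc k) powr a \<le> 2 powr a * real k powr a" by (simp add: powr_mult)
    from mult_right_mono[OF this, of "\<bar>\<Theta> k\<bar>"]
    have "real (Suc k) powr a * \<bar>\<Theta> k\<bar> \<le> 2 powr a * \<bar>real k powr a * \<Theta> k\<bar>"
      by (simp add: abs_mult mult.assoc)
    also have "\<dots> \<le> 2 powr a * B" using B(2)[of k] by (intro mult_left_mono) auto
    also have "\<dots> \<le> C" by (simp add: C_def)
    finally show ?thesis by (simp add: powr_minus field_simps)
  qed
  show thesis
  proof (rule that[OF C], intro allI impI)
    fix g :: "'a \<Rightarrow> real" and K k
    assume g: "K-lipschitz_on UNIV g" "\<forall>x. 0 \<le> g x \<and> g x \<le> 1"
    note N = lipschitz_norm_le[OF g(1) g(2)[rule_format]]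
    have "(\<integral>x. g ((f ^^ k) x) * g x \<partial>M) - (\<integral>x. g x \<partial>M)\<^sup>2
        \<le> lipschitz_norm g * lipschitz_norm g * \<Theta> k"
      using dec[rule_format, OF N(1) N(1), of k] by (simp add: power2_eq_square)
    also have "\<dots> \<le> (lipschitz_norm g)\<^sup>2 * \<bar>\<Theta> k\<bar>"
      by (simp add: power2_eq_square mult_left_mono)
    also have "\<dots> \<le> (1 + K)\<^sup>2 * (C * real (Suc k) powr - a)"
      using N bound by (intro mult_mono power_mono) auto
    finally show "(\<integral>x. g ((f ^^ k) x) * g x \<partial>M) - (\<integral>x. g x \<partial>M)\<^sup>2
             \<le> (1 + K)\<^sup>2 * C * real (Suc k) powr - a" by (simp add: mult.assoc)
  qed
qed

lemma lipschitz_cutoff: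
  fixes \<psi> :: "'a::metric_space \<Rightarrow> real" and v u :: real
  assumes L: "L-lipschitz_on UNIV \<psi>" and vu: "v < u"
  obtains g :: "'a \<Rightarrow> real" where "(L / (u - v))-lipschitz_on UNIV g"
    and "\<And>x. 0 \<le> g x \<and> g x \<le> 1" and "\<And>x. \<psi> x \<le> v \<Longrightarrow> g x = 1" and "\<And>x. u < \<psi> x \<Longrightarrow> g x = 0"
proof
  define g where "g x = max 0 (min 1 ((u - \<psi> x) / (u - v)))" for x
  show "(L / (u - v))-lipschitz_on UNIV g"
  proof (rule lipschitz_onI)
    fix x y
    have "\<bar>g x - g y\<bar> \<le> \<bar>(u - \<psi> x) / (u - v) - (u - \<psi> y) / (u - v)\<bar>"
      unfolding g_def by linarith
    also have "\<dots> = \<bar>\<psi> x - \<psi> y\<bar> / (u - v)"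
      using vu by (simp add: diff_divide_distrib[symmetric] abs_divide abs_minus_commute)
    also have "\<dots> \<le> L * dist x y / (u - v)"
      using lipschitz_onD[OF L, of x y] vu by (intro divide_right_mono) (auto simp: dist_real_def)
    finally show "dist (g x) (g y) \<le> L / (u - v) * dist x y" by (simp add: dist_real_def)
  qed (use lipschitz_on_nonneg[OF L] vu in auto)
  show "0 \<le> g x \<and> g x \<le> 1" for x by (auto simp: g_def)
  show "g x = 1" if "\<psi> x \<le> v" for x
    using that vu by (simp add: g_def)
  show "g x = 0" if "u < \<psi> x" for x
  proof -
    have "(u - \<psi> x) / (u - v) < 0" using that vu by (intro divide_neg_pos) auto
    then show ?thesis by (simp add: g_def)
  qed
qed

text \<open>Two competing bounds on a covariance are traded off here: \<open>A\<close> is small but not summable over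
  the lag, \<open>B\<close> is summable but large.\<close>
lemma le_interpolate:
  fixes x A B \<theta> :: real
  assumes "x \<le> A" "x \<le> B" "0 \<le> A" "0 \<le> B" "0 \<le> \<theta>" "\<theta> \<le> 1"
  shows "x \<le> A powr (1 - \<theta>) * B powr \<theta>"
proof (cases "x \<le> 0")
  case True
  then show ?thesis by (meson mult_nonneg_nonneg order_trans powr_ge_zero)
next
  case False
  then have "x = x powr (1 - \<theta>) * x powr \<theta>" by (simp add: powr_add[symmetric])
  also have "\<dots> \<le> A powr (1 - \<theta>) * B powr \<theta>"
    using False assms by (intro mult_mono powr_mono2) auto
  finally show ?thesis .
qed

section \<open>Regular suplevels\<close>

lemma measurable_suplevel:
  assumes "sets M = sets borel" "\<phi> \<in> borel_measurable M"
  shows "suplevel \<phi> n \<in> sets M"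
proof -
  have "space M = UNIV" using sets_eq_imp_space_eq[OF assms(1)] by simp
  then have "suplevel \<phi> n = {x \<in> space M. real n \<le> \<phi> x}" by (auto simp: suplevel_def)
  also have "\<dots> \<in> sets M" using assms(2) by measurable
  finally show ?thesis .
qed

lemma measure_suplevel_antimono:
  assumes "prob_space M" "sets M = sets borel" "\<phi> \<in> borel_measurable M" "m \<le> n"
  shows "measure M (suplevel \<phi> n) \<le> measure M (suplevel \<phi> m)"
proof -
  interpret prob_space M by fact
  show ?thesis
    using assms(4) measurable_suplevel[OF assms(2,3)]
    by (intro finite_measure_mono) (auto simp: suplevel_def)
qed

text \<open>The strict lower bound on the ratio of consecutive measures makes some later, hence smaller,
  suplevel have positive measure.\<close>
lemma measure_suplevel_pos:
  assumes "prob_space M" "sets M = sets borel" "\<phi> \<in> borel_measurable M" "regular_suplevels M \<phi>"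
  shows "0 < measure M (suplevel \<phi> n)"
proof -
  obtain c where "c > 0" and "\<forall>\<^sub>F n in sequentially.
        measure M (suplevel \<phi> (n + 1)) > c * measure M (suplevel \<phi> n)"
    using assms(4) unfolding regular_suplevels_def by blast
  then obtain k where "k \<ge> n" "measure M (suplevel \<phi> (k + 1)) > c * measure M (suplevel \<phi> k)"
    unfolding eventually_sequentially by (meson max.cobounded1 max.cobounded2)
  moreover have "c * measure M (suplevel \<phi> k) \<ge> 0" using \<open>c > 0\<close> by simp
  moreover have "measure M (suplevel \<phi> n) \<ge> measure M (suplevel \<phi> (k + 1))"
    by (rule measure_suplevel_antimono[OF assms(1-3)]) (use \<open>k \<ge> n\<close> in simp)
  ultimately show ?thesis by linarith
qed

text \<open>The measures of two consecutive suplevels may be equal or almost equal, which would leave no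
  room for a cutoff function. Waiting until the measure has halved makes room, and the
  bounded ratio of consecutive measures ensures that the first such index has not
  lost more than a constant factor.\<close>
lemma halving_suplevel:
  assumes M: "prob_space M" "sets M = sets borel" "\<phi> \<in> borel_measurable M"
    and \<phi>: "regular_suplevels M \<phi>"
  obtains c m0 where "0 < c" and "\<And>m. m0 \<le> m \<Longrightarrow> \<exists>m'\<ge>m.
      c * measure M (suplevel \<phi> m) \<le> measure M (suplevel \<phi> m') \<and>
      measure M (suplevel \<phi> m') \<le> measure M (suplevel \<phi> m) / 2"
proof -
  let ?\<mu> = "\<lambda>m. measure M (suplevel \<phi> m)"
  note pos = measure_suplevel_pos[OF M \<phi>]
  note anti = measure_suplevel_antimono[OF M]
  have lim: "?\<mu> \<longlonglongrightarrow> 0" using \<phi> by (simp add: regular_suplevels_def)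
  obtain c where c: "c > 0" and ev: "\<forall>\<^sub>F n in sequentially. ?\<mu> (n + 1) > c * ?\<mu> n"
    using \<phi> unfolding regular_suplevels_def by blast
  obtain m0 where m0: "\<And>n. m0 \<le> n \<Longrightarrow> ?\<mu> (n + 1) > c * ?\<mu> n"
    using ev unfolding eventually_sequentially by blast
  show thesis
  proof (rule that)
    show "0 < c / 2" using c by simp
    fix m assume m: "m0 \<le> m"
    have "\<forall>\<^sub>F k in sequentially. ?\<mu> k < ?\<mu> m / 2"
      using lim pos[of m] by (intro order_tendstoD) auto
    then obtain k0 where k0: "?\<mu> k0 \<le> ?\<mu> m / 2"
      unfolding eventually_sequentially by (meson less_imp_le order_refl)
    define k where "k = (LEAST k. ?\<mu> k \<le> ?\<mu> m / 2)"
    have k: "?\<mu> k \<le> ?\<mu> m / 2" unfolding k_def by (rule LeastI[of _ k0]) (rule k0)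
    have "\<not> k \<le> m" using k anti[of k m] pos[of m] by auto
    then obtain j where j: "k = Suc j" "m \<le> j" by (cases k) auto
    have "j < (LEAST k. ?\<mu> k \<le> ?\<mu> m / 2)" using j(1) unfolding k_def[symmetric] by simp
    from not_less_Least[OF this] have "\<not> ?\<mu> j \<le> ?\<mu> m / 2" .
    then have "c * (?\<mu> m / 2) \<le> c * ?\<mu> j" using c by simp
    also have "\<dots> \<le> ?\<mu> k" using m0[of j] m j by simp
    finally show "\<exists>m'\<ge>m. c / 2 * ?\<mu> m \<le> ?\<mu> m' \<and> ?\<mu> m' \<le> ?\<mu> m / 2"
      using k \<open>\<not> k \<le> m\<close> by (intro exI[of _ k]) auto
  qed
qed

text \<open>The exponent \<open>\<beta> = 0\<close> is impossible: all suplevels would coincide with the set where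
  \<open>\<psi> \<le> 1\<close>, while their measures are positive and tend to 0.\<close>
lemma lipschitz_description:
  assumes M: "prob_space M" "sets M = sets borel" "\<phi> \<in> borel_measurable M"
    and \<phi>: "regular_suplevels M \<phi>"
  obtains \<beta> L :: real and \<psi> :: "'a::metric_space \<Rightarrow> real" where "0 < \<beta>" "L-lipschitz_on UNIV \<psi>"
    and "\<And>n x. 1 \<le> n \<Longrightarrow> x \<in> suplevel \<phi> n \<longleftrightarrow> \<psi> x \<le> measure M (suplevel \<phi> n) powr \<beta>"
proof -
  let ?\<mu> = "\<lambda>m. measure M (suplevel \<phi> m)"
  obtain \<beta> L :: real and \<psi> :: "'a \<Rightarrow> real" where \<beta>: "0 \<le> \<beta>" and L: "L-lipschitz_on UNIV \<psi>"
    and A': "\<And>n. 1 \<le> n \<Longrightarrow> suplevel \<phi> n = {x. \<psi> x \<le> ?\<mu> n powr \<beta>}"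
    using \<phi> unfolding regular_suplevels_def by blast
  have A: "x \<in> suplevel \<phi> n \<longleftrightarrow> \<psi> x \<le> ?\<mu> n powr \<beta>" if "1 \<le> n" for n x
    using arg_cong[OF A'[OF that], of "\<lambda>S. x \<in> S"] by (simp only: mem_Collect_eq)
  have "\<beta> \<noteq> 0"
  proof
    assume "\<beta> = 0"
    then have "suplevel \<phi> n = {x. \<psi> x \<le> 1}" if "1 \<le> n" for n
      using that A measure_suplevel_pos[OF M \<phi>, of n] by (intro set_eqI) simp
    then have "?\<mu> n = ?\<mu> 1" if "1 \<le> n" for n using that by simp
    then have "\<forall>\<^sub>F n in sequentially. ?\<mu> n = ?\<mu> 1"
      unfolding eventually_sequentially by blast
    then have "?\<mu> \<longlonglongrightarrow> ?\<mu> 1" by (rule tendsto_eventually)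
    moreover have "?\<mu> \<longlonglongrightarrow> 0" using \<phi> by (simp add: regular_suplevels_def)
    ultimately have "?\<mu> 1 = 0" by (rule LIMSEQ_unique)
    then show False using measure_suplevel_pos[OF M \<phi>, of 1] by simp
  qed
  then have "0 < \<beta>" using \<beta> by simp
  then show thesis using L A by (rule that)
qed

section \<open>The probability of not visiting a suplevel\<close>

text \<open>The mean return time to a set of measure \<open>\<mu>\<close> is \<open>1/\<mu>\<close>; this is the matching tail bound
  up to the loss \<open>\<mu>\<^sup>-\<^sup>\<eta>\<close>. By polynomial decay of order \<open>2/\<theta>\<close>, the covariance of the cutoff
  function at lag \<open>k\<close> is at most a constant times both \<open>\<mu>\<close> and \<open>\<mu>\<^sup>-\<^sup>2\<^sup>\<beta> (k+1)\<^sup>-\<^sup>2\<^sup>/\<^sup>\<theta>\<close>.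
  Interpolation with weight \<open>\<theta>\<close> turns this into \<open>\<mu>\<^sup>1\<^sup>-\<^sup>\<theta>\<^sup>-\<^sup>2\<^sup>\<beta>\<^sup>\<theta> (k+1)\<^sup>-\<^sup>2\<close>, which is summable over
  \<open>k\<close>, and \<open>\<theta>\<close> is chosen so that the exponent of \<open>\<mu>\<close> is \<open>1 - \<eta>\<close>.\<close>
lemma prob_no_visit_suplevel_le:
  fixes M :: "'a::metric_space measure"
  assumes mps: "measure_preserving_system M f" and sets: "sets M = sets borel"
    and spdc: "SPDC M f" and \<phi>: "\<phi> \<in> borel_measurable M" "regular_suplevels M \<phi>"
    and \<eta>: "0 < \<eta>" "\<eta> \<le> 1"
  obtains C m0 where "0 < C" and "\<And>m n. m0 \<le> m \<Longrightarrow> 0 < n \<Longrightarrow>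
      measure M {x \<in> space M. \<forall>k<n. (f ^^ k) x \<notin> suplevel \<phi> m}
        \<le> C / (real n * measure M (suplevel \<phi> m) powr (1 + \<eta>))"
proof -
  interpret measure_preserving_system M f by fact
  let ?\<mu> = "\<lambda>m. measure M (suplevel \<phi> m)"
  note M = prob_space_axioms sets \<phi>(1)
  note pos = measure_suplevel_pos[OF M \<phi>(2)]
  obtain c m0 where c: "0 < c" and half: "\<And>m. m0 \<le> m \<Longrightarrow> \<exists>m'\<ge>m.
      c * ?\<mu> m \<le> ?\<mu> m' \<and> ?\<mu> m' \<le> ?\<mu> m / 2"
    using halving_suplevel[OF M \<phi>(2)] by blast
  obtain \<beta> L :: real and \<psi> :: "'a \<Rightarrow> real" where \<beta>: "0 < \<beta>" and L: "L-lipschitz_on UNIV \<psi>"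
    and A: "\<And>n x. 1 \<le> n \<Longrightarrow> x \<in> suplevel \<phi> n \<longleftrightarrow> \<psi> x \<le> ?\<mu> n powr \<beta>"
    using lipschitz_description[OF M \<phi>(2)] by blast
  define \<theta> where "\<theta> = \<eta> / (1 + 2 * \<beta>)"
  have \<theta>: "0 < \<theta>" "\<theta> \<le> 1" using \<eta> \<beta> by (auto simp: \<theta>_def)
  have "\<theta> * (1 + 2 * \<beta>) = \<eta>" using \<beta> by (simp add: \<theta>_def)
  then have \<theta>\<eta>: "\<theta> + 2 * \<beta> * \<theta> = \<eta>" by (simp add: algebra_simps)
  have pos2: "0 < 2 / \<theta>" using \<theta> by simp
  obtain B where B: "0 < B" and decay: "\<forall>(g :: 'a \<Rightarrow> real) K k.
      K-lipschitz_on UNIV g \<longrightarrow> (\<forall>x. 0 \<le> g x \<and> g x \<le> 1) \<longrightarrow>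
      (\<integral>x. g ((f ^^ k) x) * g x \<partial>M) - (\<integral>x. g x \<partial>M)\<^sup>2
        \<le> (1 + K)\<^sup>2 * B * real (Suc k) powr - (2 / \<theta>)"
    by (rule SPDC_polynomial_decay[OF spdc pos2])
  have L0: "0 \<le> L" using lipschitz_on_nonneg[OF L] .
  (* Halving the measure shrinks its power with exponent \<beta> by the factor 1 - q, so the cutoff
     has Lipschitz constant at most K0 * \<mu> powr -\<beta>. *)
  define q where "q = 1 - 2 powr - \<beta>"
  have q: "0 < q" using \<beta> powr_less_mono[of "-\<beta>" 0 2] by (simp add: q_def)
  define K0 where "K0 = L / q"
  have K0: "0 \<le> K0" using L0 q by (simp add: K0_def)
  define E where "E = (1 + K0)\<^sup>2 * B"
  have E: "0 < E" unfolding E_def using K0 B by (intro mult_pos_pos zero_less_power) auto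
  define Z where "Z = (\<Sum>k. real (Suc k) powr - 2)"
  have sumZ: "summable (\<lambda>k. real (Suc k) powr - 2)"
    using summable_Suc_iff[of "\<lambda>k. real k powr - 2"] by (simp add: summable_real_powr_iff)
  have Z: "0 < Z" unfolding Z_def by (rule suminf_pos[OF sumZ]) auto
  show thesis
  proof (rule that)
    show "0 < 2 * E powr \<theta> * Z / c\<^sup>2" using E Z c by simp
    fix m n assume "max m0 1 \<le> m" and n: "0 < (n::nat)"
    then have m: "m0 \<le> m" "1 \<le> m" by auto
    obtain m' where m': "m \<le> m'" "c * ?\<mu> m \<le> ?\<mu> m'" "?\<mu> m' \<le> ?\<mu> m / 2"
      using half[OF m(1)] by blast
    define \<mu> where "\<mu> = ?\<mu> m"
    have \<mu>: "0 < \<mu>" "\<mu> \<le> 1" using pos by (auto simp: \<mu>_def)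
    define u v where "u = \<mu> powr \<beta>" and "v = ?\<mu> m' powr \<beta>"
    have "v \<le> (\<mu> / 2) powr \<beta>" unfolding v_def
      using m'(3) \<beta> by (intro powr_mono2) (auto simp: \<mu>_def)
    also have "\<dots> = u * 2 powr - \<beta>"
      using \<mu> by (simp add: u_def powr_divide powr_minus field_simps)
    finally have gap: "q * u \<le> u - v" by (simp add: q_def algebra_simps)
    have u: "0 < u" using \<mu> by (simp add: u_def)
    have uv: "v < u" using gap q u mult_pos_pos[of q u] by linarith
    obtain g :: "'a \<Rightarrow> real" where g_lip: "(L / (u - v))-lipschitz_on UNIV g"
      and g01: "\<And>x. 0 \<le> g x \<and> g x \<le> 1" and g1: "\<And>x. \<psi> x \<le> v \<Longrightarrow> g x = 1"
      and g0: "\<And>x. u < \<psi> x \<Longrightarrow> g x = 0"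
      using lipschitz_cutoff[OF L uv] by blast
    have g1': "g x = 1" if "x \<in> suplevel \<phi> m'" for x
      using A[of m'] that m m' g1 by (auto simp: v_def)
    have g0': "g x = 0" if "x \<notin> suplevel \<phi> m" for x
      using A[of m] that m g0 by (auto simp: u_def \<mu>_def not_le)
    define K where "K = K0 * \<mu> powr - \<beta>"
    have "L / (u - v) \<le> L / (q * u)"
      using gap q u L0 uv by (intro divide_left_mono) auto
    also have "\<dots> = K" by (simp add: K_def K0_def u_def powr_minus field_simps)
    finally have lip: "K-lipschitz_on UNIV g" by (rule lipschitz_on_mono[OF g_lip order_refl])
    have [measurable]: "g \<in> borel_measurable M"
      by (subst measurable_cong_sets[OF sets refl])
         (rule borel_measurable_continuous_onI[OF lipschitz_on_continuous_on[OF lip]])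
    define p where "p = (\<integral>x. g x \<partial>M)"
    have ig: "integrable M g"
      by (rule integrable_const_bound[where B=1]) (use g01 in auto)
    have igg: "integrable M (\<lambda>x. g ((f ^^ k) x) * g x)" for k
      by (rule integrable_const_bound[where B=1]) (use g01 in \<open>auto simp: abs_mult mult_le_one\<close>)
    note [measurable] = measurable_suplevel[OF sets \<phi>(1)]
    have ind: "integrable M (\<lambda>x. indicator (suplevel \<phi> k) x :: real)" for k
      by (rule integrable_const_bound[where B=1]) auto
    have "?\<mu> m' \<le> p"
    proof -
      have "(\<integral>x. indicator (suplevel \<phi> m') x \<partial>M) \<le> p" unfolding p_def
        by (rule integral_mono[OF ind ig]) (use g01 g1' in \<open>auto simp: indicator_def\<close>)
      then show ?thesis by simp
    qed
    then have p: "c * \<mu> \<le> p" using m'(2) by (simp add: \<mu>_def)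
    have p_le: "p \<le> \<mu>"
    proof -
      have "p \<le> (\<integral>x. indicator (suplevel \<phi> m) x \<partial>M)" unfolding p_def
        by (rule integral_mono[OF ig ind]) (use g01 g0' in \<open>auto simp: indicator_def\<close>)
      then show ?thesis by (simp add: \<mu>_def)
    qed
    have c\<mu>: "0 < c * \<mu>" using c \<mu> by simp
    have p0: "0 < p" using p c\<mu> by linarith
    define D where "D = E powr \<theta> * \<mu> powr (1 - \<eta>)"
    have cov: "(\<integral>x. g ((f ^^ k) x) * g x \<partial>M) - (\<integral>x. g x \<partial>M)\<^sup>2 \<le> D * real (Suc k) powr - 2" for k
    proof -
      let ?x = "(\<integral>x. g ((f ^^ k) x) * g x \<partial>M) - (\<integral>x. g x \<partial>M)\<^sup>2"
      have "(\<integral>x. g ((f ^^ k) x) * g x \<partial>M) \<le> p" unfolding p_def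
        by (rule integral_mono[OF igg ig]) (use g01 in \<open>auto intro: mult_left_le_one_le\<close>)
      then have 1: "?x \<le> \<mu>" using p_le zero_le_power2[of "\<integral>x. g x \<partial>M"] by linarith
      have "1 \<le> \<mu> powr - \<beta>" using \<mu> \<beta> by (simp add: powr_minus one_le_inverse_iff powr_le1)
      then have "1 + K \<le> (1 + K0) * \<mu> powr - \<beta>" by (simp add: K_def algebra_simps)
      then have "(1 + K)\<^sup>2 \<le> ((1 + K0) * \<mu> powr - \<beta>)\<^sup>2"
        using K0 by (intro power_mono) (auto simp: K_def)
      also have "\<dots> = (1 + K0)\<^sup>2 * \<mu> powr - (2 * \<beta>)"
        by (simp add: power_mult_distrib power2_eq_square powr_add[symmetric])
      finally have "(1 + K)\<^sup>2 * (B * real (Suc k) powr - (2 / \<theta>))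
          \<le> ((1 + K0)\<^sup>2 * \<mu> powr - (2 * \<beta>)) * (B * real (Suc k) powr - (2 / \<theta>))"
        using B by (intro mult_right_mono) auto
      then have 2: "?x \<le> E * \<mu> powr - (2 * \<beta>) * real (Suc k) powr - (2 / \<theta>)"
        using decay[rule_format, OF lip g01, of k] by (simp add: E_def mult_ac)
      have "?x \<le> \<mu> powr (1 - \<theta>) * (E * \<mu> powr - (2 * \<beta>) * real (Suc k) powr - (2 / \<theta>)) powr \<theta>"
        by (rule le_interpolate[OF 1 2]) (use \<mu> E \<theta> in auto)
      also have "\<dots> = \<mu> powr (1 - \<theta>) * (E powr \<theta> * \<mu> powr - (2 * \<beta> * \<theta>) * real (Suc k) powr - 2)"
        using E \<mu> \<theta> by (simp add: powr_mult powr_powr)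
      also have "\<dots> = E powr \<theta> * \<mu> powr (1 - \<theta> - 2 * \<beta> * \<theta>) * real (Suc k) powr - 2"
        using powr_add[of \<mu> "1 - \<theta>" "- (2 * \<beta> * \<theta>)"] by simp
      also have "1 - \<theta> - 2 * \<beta> * \<theta> = 1 - \<eta>" using \<theta>\<eta> by simp
      finally show ?thesis by (simp add: D_def)
    qed
    have "prob {x \<in> space M. \<forall>k<n. (f ^^ k) x \<notin> suplevel \<phi> m}
        \<le> 2 * (\<Sum>k. D * real (Suc k) powr - 2) / (real n * (\<integral>x. g x \<partial>M)\<^sup>2)"
    proof (rule prob_no_visit_le)
      show "0 < (\<integral>x. g x \<partial>M)" using p0 by (simp add: p_def)
      show "summable (\<lambda>k. D * real (Suc k) powr - 2)" by (rule summable_mult[OF sumZ])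
    qed (use g01 cov g0' n in \<open>auto simp: D_def\<close>)
    also have "(\<Sum>k. D * real (Suc k) powr - 2) = D * Z"
      unfolding Z_def by (rule suminf_mult[OF sumZ])
    also have "2 * (D * Z) / (real n * (\<integral>x. g x \<partial>M)\<^sup>2) \<le> 2 * (D * Z) / (real n * (c * \<mu>)\<^sup>2)"
      using p p0 c \<mu> n Z unfolding p_def[symmetric]
      by (intro divide_left_mono mult_left_mono power_mono mult_pos_pos zero_less_power)
         (auto simp: D_def)
    also have "\<dots> = 2 * E powr \<theta> * Z / c\<^sup>2 / (real n * \<mu> powr (1 + \<eta>))"
    proof -
      have "\<mu> powr (1 - \<eta>) * \<mu> powr (1 + \<eta>) = \<mu>\<^sup>2"
        using \<mu> by (simp add: powr_add[symmetric])
      then show ?thesis using \<mu> c n by (simp add: D_def field_simps power_mult_distrib)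
    qed
    finally show "prob {x \<in> space M. \<forall>k<n. (f ^^ k) x \<notin> suplevel \<phi> m}
        \<le> 2 * E powr \<theta> * Z / c\<^sup>2 / (real n * ?\<mu> m powr (1 + \<eta>))" by (simp add: \<mu>_def)
  qed
qed

section \<open>Growth of the maximum\<close>

text \<open>Maxima and sums of nonnegative terms are monotone in time, so almost sure statements need
  Borel--Cantelli only along powers of two.\<close>
lemma eventually_dyadic:
  fixes P :: "nat \<Rightarrow> bool"
  assumes Q: "\<forall>\<^sub>F j in sequentially. Q j"
    and QP: "\<And>j n. Q j \<Longrightarrow> 2 ^ j \<le> n \<Longrightarrow> n \<le> 2 ^ Suc j \<Longrightarrow> P n"
  shows "\<forall>\<^sub>F n in sequentially. P n"
proof -
  obtain J where J: "\<And>j. J \<le> j \<Longrightarrow> Q j" using Q unfolding eventually_sequentially by blast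
  have "P n" if n: "2 ^ J \<le> n" for n
  proof -
    have "1 \<le> n" using n one_le_power[of 2 J] by (meson le_trans one_le_numeral)
    then obtain j where j: "2 ^ j \<le> n" "n < 2 ^ (j + 1)"
      using ex_power_ivl1[of 2 n] by auto
    have "(2::nat) ^ J < 2 ^ (j + 1)" using n j by linarith
    then have "J < j + 1" by (rule power_less_imp_less_exp[rotated]) simp
    then show ?thesis using QP[OF J[of j] j(1)] j(2) by simp
  qed
  then show ?thesis unfolding eventually_sequentially by blast
qed

lemma eventually_measure_suplevel_gt:
  assumes pos: "\<And>n. 0 < measure M (suplevel \<phi> n)"
    and lim: "(\<lambda>n. ln (measure M (suplevel \<phi> n)) / (- ln (real n))) \<longlonglongrightarrow> \<alpha>" and s: "\<alpha> < s"
  shows "\<forall>\<^sub>F n in sequentially. real n powr - s < measure M (suplevel \<phi> n)"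
  using order_tendstoD(2)[OF lim s] eventually_gt_at_top[of 1]
proof eventually_elim
  case (elim n)
  then have "ln (real n powr - s) < ln (measure M (suplevel \<phi> n))"
    by (simp add: ln_powr minus_divide_left[symmetric] field_simps)
  then show ?case using elim pos[of n] by (subst (asm) ln_less_cancel_iff) auto
qed

lemma eventually_measure_suplevel_less:
  assumes pos: "\<And>n. 0 < measure M (suplevel \<phi> n)"
    and lim: "(\<lambda>n. ln (measure M (suplevel \<phi> n)) / (- ln (real n))) \<longlonglongrightarrow> \<alpha>" and s: "s < \<alpha>"
  shows "\<forall>\<^sub>F n in sequentially. measure M (suplevel \<phi> n) < real n powr - s"
  using order_tendstoD(1)[OF lim s] eventually_gt_at_top[of 1]
proof eventually_elim
  case (elim n)
  then have "ln (measure M (suplevel \<phi> n)) < ln (real n powr - s)"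
    by (simp add: ln_powr minus_divide_left[symmetric] field_simps)
  then show ?case using elim pos[of n] by (subst (asm) ln_less_cancel_iff) auto
qed

lemma le_birkhoff_max: "k < n \<Longrightarrow> \<phi> ((f ^^ k) x) \<le> birkhoff_max f \<phi> n x"
  unfolding birkhoff_max_def by (intro Max_ge) auto

lemma birkhoff_max_attained:
  assumes "0 < n"
  obtains k where "k < n" "birkhoff_max f \<phi> n x = \<phi> ((f ^^ k) x)"
proof -
  have "birkhoff_max f \<phi> n x \<in> (\<lambda>k. \<phi> ((f ^^ k) x)) ` {..<n}"
    unfolding birkhoff_max_def using assms by (intro Max_in) auto
  then show thesis using that by auto
qed

lemma birkhoff_max_le_sum:
  assumes "\<And>x. 0 \<le> \<phi> x" "0 < n"
  shows "birkhoff_max f \<phi> n x \<le> birkhoff_sum f \<phi> n x"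
proof -
  obtain k where "k < n" "birkhoff_max f \<phi> n x = \<phi> ((f ^^ k) x)"
    using birkhoff_max_attained[OF assms(2)] .
  then show ?thesis unfolding birkhoff_sum_def
    using member_le_sum[of k "{..<n}" "\<lambda>k. \<phi> ((f ^^ k) x)"] assms(1) by auto
qed

text \<open>The growing maximum is attained at two different times with different positive values. At
  least one of them is not the time at which the current maximum is attained, and its
  positive value is part of the excess of the sum over the maximum.\<close>
lemma eventually_birkhoff_max_less_sum:
  assumes \<phi>: "\<And>x. 0 \<le> \<phi> x" and r: "0 < r"
    and ev: "\<forall>\<^sub>F n in sequentially. real n powr r \<le> birkhoff_max f \<phi> n x"
  shows "\<forall>\<^sub>F n in sequentially. birkhoff_max f \<phi> n x < birkhoff_sum f \<phi> n x"
proof -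
  let ?a = "\<lambda>k. \<phi> ((f ^^ k) x)"
  obtain N0 where N0: "\<And>n. N0 \<le> n \<Longrightarrow> real n powr r \<le> birkhoff_max f \<phi> n x"
    using ev unfolding eventually_sequentially by blast
  define N where "N = max 1 N0"
  have N: "0 < N" "\<And>n. N \<le> n \<Longrightarrow> real n powr r \<le> birkhoff_max f \<phi> n x"
    using N0 by (auto simp: N_def)
  obtain k1 where k1: "k1 < N" "birkhoff_max f \<phi> N x = ?a k1"
    using birkhoff_max_attained[OF N(1)] .
  have a1: "0 < ?a k1"
  proof -
    have "0 < real N powr r" using N(1) by simp
    also have "\<dots> \<le> ?a k1" using N(2)[of N] k1(2) by simp
    finally show ?thesis .
  qed
  have "filterlim (\<lambda>n. real n powr r) at_top sequentially"
    using r by real_asymp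
  then have "\<forall>\<^sub>F n in sequentially. ?a k1 < real n powr r"
    by (simp add: filterlim_at_top_dense)
  then obtain n where n: "N \<le> n" "?a k1 < real n powr r"
    unfolding eventually_sequentially by (meson max.cobounded1 max.cobounded2)
  obtain k2 where k2: "k2 < n" "birkhoff_max f \<phi> n x = ?a k2"
    using birkhoff_max_attained[of n f \<phi> x] N(1) n(1) by auto
  have a2: "?a k1 < ?a k2" using n N(2)[OF n(1)] k2 by simp
  have "birkhoff_max f \<phi> m x < birkhoff_sum f \<phi> m x" if m: "n \<le> m" for m
  proof -
    obtain k where k: "k < m" "birkhoff_max f \<phi> m x = ?a k"
      using birkhoff_max_attained[of m f \<phi> x] N(1) n(1) m by auto
    obtain l where l: "l < m" "l \<noteq> k" "0 < ?a l"
    proof (cases "k = k1")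
      case True
      then show ?thesis using that[of k2] a1 a2 k2 m by auto
    next
      case False
      then show ?thesis using that[of k1] a1 k1 n m by auto
    qed
    have "?a k < sum ?a {k, l}" using l by simp
    also have "\<dots> \<le> sum ?a {..<m}"
      using k l \<phi> by (intro sum_mono2) auto
    finally show ?thesis using k by (simp add: birkhoff_sum_def)
  qed
  then show ?thesis unfolding eventually_sequentially by blast
qed

text \<open>Exponents \<open>\<alpha> < s\<close> and \<open>s (1 + \<eta>) < \<gamma>\<close> leave enough room for both losses, the one in
  the measure of the suplevels and the one in the tail bound.\<close>
theorem AE_eventually_birkhoff_max_ge:
  fixes M :: "'a::metric_space measure"
  assumes mps: "measure_preserving_system M f" and sets: "sets M = sets borel"
    and spdc: "SPDC M f" and \<phi>: "\<phi> \<in> borel_measurable M" "regular_suplevels M \<phi>"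
    and lim: "(\<lambda>n. ln (measure M (suplevel \<phi> n)) / (- ln (real n))) \<longlonglongrightarrow> \<alpha>"
    and \<alpha>: "0 \<le> \<alpha>" "\<alpha> < \<gamma>"
  shows "AE x in M. \<forall>\<^sub>F n in sequentially. real n powr (1 / \<gamma>) \<le> birkhoff_max f \<phi> n x"
proof -
  interpret measure_preserving_system M f by fact
  let ?\<mu> = "\<lambda>m. measure M (suplevel \<phi> m)"
  note pos = measure_suplevel_pos[OF prob_space_axioms sets \<phi>]
  note [measurable] = measurable_suplevel[OF sets \<phi>(1)]
  define s where "s = (\<alpha> + \<gamma>) / 2"
  have s: "\<alpha> < s" "0 < s" "s < \<gamma>" using \<alpha> by (auto simp: s_def)
  define \<eta> where "\<eta> = min 1 ((\<gamma> - s) / (2 * s))"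
  have \<eta>: "0 < \<eta>" "\<eta> \<le> 1" using s by (auto simp: \<eta>_def)
  define r where "r = s * (1 + \<eta>)"
  have "s * \<eta> \<le> s * ((\<gamma> - s) / (2 * s))" using s by (intro mult_left_mono) (auto simp: \<eta>_def)
  also have "\<dots> = (\<gamma> - s) / 2" using s by simp
  finally have r: "0 < r" "r < \<gamma>" using s \<eta> by (auto simp: r_def algebra_simps add_pos_pos)
  obtain C m0 where C: "0 < C" and novisit: "\<And>m n. m0 \<le> m \<Longrightarrow> 0 < n \<Longrightarrow>
      prob {x \<in> space M. \<forall>k<n. (f ^^ k) x \<notin> suplevel \<phi> m}
        \<le> C / (real n * ?\<mu> m powr (1 + \<eta>))"
    using prob_no_visit_suplevel_le[OF mps sets spdc \<phi> \<eta>] by blast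
  (* The level to be exceeded before time 2^j must serve all n up to 2^(j+1). *)
  define y where "y j = 2 powr (real (Suc j) / \<gamma>)" for j
  define m where "m j = nat \<lceil>y j\<rceil>" for j
  have y1: "1 \<le> y j" for j using s unfolding y_def by (intro ge_one_powr_ge_zero) auto
  have my: "y j \<le> real (m j)" "real (m j) \<le> 2 * y j" for j
    using y1[of j] unfolding m_def by linarith+
  have "filterlim y at_top sequentially"
    unfolding y_def using s by real_asymp
  then have "filterlim (\<lambda>j. real (m j)) at_top sequentially"
    by (rule filterlim_at_top_mono) (use my in auto)
  then have mlim: "filterlim m at_top sequentially"
    by (simp add: filterlim_real_sequentially filterlim_at_top_imp_at_infinity
        filterlim_sequentially_iff_filterlim_real)
  define bad where "bad j = {x \<in> space M. \<forall>k<2 ^ j. (f ^^ k) x \<notin> suplevel \<phi> (m j)}" for j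
  have bad_sets: "bad j \<in> sets M" for j unfolding bad_def by measurable
  define \<rho> where "\<rho> = 2 powr (r / \<gamma> - 1)"
  have \<rho>: "0 < \<rho>" "\<rho> < 1" using r s powr_less_mono[of "r / \<gamma> - 1" 0 2] by (auto simp: \<rho>_def)
  have small: "\<forall>\<^sub>F j in sequentially. prob (bad j) \<le> C * 2 powr (r + r / \<gamma>) * \<rho> ^ j"
    using eventually_compose_filterlim[OF eventually_measure_suplevel_gt[OF pos lim s(1)] mlim]
      eventually_compose_filterlim[OF eventually_ge_at_top[of m0] mlim]
  proof eventually_elim
    case (elim j)
    have m_pos: "0 < real (m j)" using my(1)[of j] y1[of j] by linarith
    have "(2 * y j) powr - r \<le> real (m j) powr - r"
      using my[of j] m_pos r by (intro powr_mono2') auto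
    also have "\<dots> = (real (m j) powr - s) powr (1 + \<eta>)"
      by (simp add: powr_powr r_def)
    also have "\<dots> \<le> ?\<mu> (m j) powr (1 + \<eta>)"
      using elim(1) \<eta> by (intro powr_mono2) auto
    finally have low: "(2 * y j) powr - r \<le> ?\<mu> (m j) powr (1 + \<eta>)" .
    have "prob (bad j) \<le> C / (real (2 ^ j) * ?\<mu> (m j) powr (1 + \<eta>))"
      unfolding bad_def by (rule novisit[OF elim(2)]) simp
    also have "\<dots> \<le> C / (real (2 ^ j) * (2 * y j) powr - r)"
      using low C pos[of "m j"] y1[of j]
      by (intro divide_left_mono mult_left_mono mult_pos_pos) auto
    also have "\<dots> = C * (2 * y j) powr r / 2 powr real j"
      by (simp add: powr_minus powr_realpow field_simps)
    also have "(2 * y j) powr r = 2 powr (r + real (Suc j) * (r / \<gamma>))"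
      by (simp add: y_def powr_mult powr_powr powr_add)
    also have "C * 2 powr (r + real (Suc j) * (r / \<gamma>)) / 2 powr real j
        = C * 2 powr (r + real (Suc j) * (r / \<gamma>) - real j)"
      by (simp add: powr_diff)
    also have "r + real (Suc j) * (r / \<gamma>) - real j = r + r / \<gamma> + (r / \<gamma> - 1) * real j"
      by (simp add: algebra_simps)
    also have "C * 2 powr (r + r / \<gamma> + (r / \<gamma> - 1) * real j) = C * 2 powr (r + r / \<gamma>) * \<rho> ^ j"
      by (simp add: \<rho>_def powr_add powr_powr[symmetric] powr_realpow)
    finally show ?case .
  qed
  have "summable (\<lambda>j. prob (bad j))"
  proof (rule summable_comparison_test_ev)
    show "\<forall>\<^sub>F j in sequentially. norm (prob (bad j)) \<le> C * 2 powr (r + r / \<gamma>) * \<rho> ^ j"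
      using small by simp
    show "summable (\<lambda>j. C * 2 powr (r + r / \<gamma>) * \<rho> ^ j)"
      using \<rho> by (intro summable_mult summable_geometric) auto
  qed
  then have "AE x in M. \<forall>\<^sub>F j in sequentially. x \<in> space M - bad j"
    using bad_sets by (intro borel_cantelli_AE1) (auto simp: emeasure_eq_measure)
  then show ?thesis
  proof eventually_elim
    case (elim x)
    then show ?case
    proof (rule eventually_dyadic)
      fix j n :: nat
      assume x: "x \<in> space M - bad j" and n: "2 ^ j \<le> n" "n \<le> 2 ^ Suc j"
      obtain k where k: "k < 2 ^ j" "(f ^^ k) x \<in> suplevel \<phi> (m j)"
        using x by (auto simp: bad_def)
      have "real n \<le> 2 powr real (Suc j)"
        using of_nat_mono[OF n(2), where 'a=real] by (subst powr_realpow) auto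
      then have "real n powr (1 / \<gamma>) \<le> (2 powr real (Suc j)) powr (1 / \<gamma>)"
        using s by (intro powr_mono2) auto
      also have "\<dots> = y j" by (simp add: y_def powr_powr)
      also have "\<dots> \<le> real (m j)" by (rule my)
      also have "\<dots> \<le> \<phi> ((f ^^ k) x)" using k by (simp add: suplevel_def)
      also have "\<dots> \<le> birkhoff_max f \<phi> n x" using k n by (intro le_birkhoff_max) auto
      finally show "real n powr (1 / \<gamma>) \<le> birkhoff_max f \<phi> n x" .
    qed
  qed
qed

section \<open>Growth of the sum\<close>

lemma powr_add_le:
  fixes a b p :: real
  assumes "0 \<le> a" "0 \<le> b" "0 \<le> p" "p \<le> 1"
  shows "(a + b) powr p \<le> a powr p + b powr p"
proof (cases "a + b = 0")
  case True
  then show ?thesis using assms by simp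
next
  case False
  define s where "s = a + b"
  have s: "0 < s" using False assms by (simp add: s_def)
  have "x \<le> s powr (1 - p) * x powr p" if "0 \<le> x" "x \<le> s" for x
  proof -
    have "x = x powr (1 - p) * x powr p"
      using that by (cases "x = 0") (simp_all add: powr_add[symmetric])
    also have "\<dots> \<le> s powr (1 - p) * x powr p"
      using that assms by (intro mult_right_mono powr_mono2) auto
    finally show ?thesis .
  qed
  from this[of a] this[of b] have "s \<le> s powr (1 - p) * (a powr p + b powr p)"
    using assms by (simp add: s_def algebra_simps)
  moreover have "s = s powr (1 - p) * s powr p" using s by (simp add: powr_add[symmetric])
  ultimately have "s powr (1 - p) * s powr p \<le> s powr (1 - p) * (a powr p + b powr p)" by linarith
  then show ?thesis using s by (simp add: s_def)
qed

lemma powr_sum_le: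
  fixes a :: "'b \<Rightarrow> real"
  assumes "\<And>k. 0 \<le> a k" "0 \<le> p" "p \<le> 1"
  shows "(\<Sum>k\<in>I. a k) powr p \<le> (\<Sum>k\<in>I. a k powr p)"
proof (induction I rule: infinite_finite_induct)
  case (insert x F)
  then show ?case
    using powr_add_le[of "a x" "sum a F" p] assms by (simp add: sum_nonneg)
qed auto

text \<open>Dyadic layers: on the set where \<open>2\<^sup>j \<le> \<phi> < 2\<^sup>j\<^sup>+\<^sup>1\<close> the integrand is at most \<open>2 powr ((j + 1) p)\<close>, and the
  measure of this set is eventually below \<open>2\<^sup>-\<^sup>j\<^sup>s\<close> for any \<open>s < \<alpha>\<close>; with
  \<open>p < s\<close> the layers are dominated by a geometric series.\<close>
lemma powr_moment_finite:
  assumes "prob_space M" "sets M = sets borel"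
    and \<phi>: "\<phi> \<in> borel_measurable M" "\<And>x. 0 \<le> \<phi> x"
    and pos: "\<And>n. 0 < measure M (suplevel \<phi> n)"
    and lim: "(\<lambda>n. ln (measure M (suplevel \<phi> n)) / (- ln (real n))) \<longlonglongrightarrow> \<alpha>"
    and p: "0 < p" "p < \<alpha>"
  shows "(\<integral>\<^sup>+x. ennreal (\<phi> x powr p) \<partial>M) < \<infinity>"
proof -
  interpret prob_space M by fact
  let ?\<mu> = "\<lambda>m. measure M (suplevel \<phi> m)"
  note [measurable] = measurable_suplevel[OF assms(2) \<phi>(1)] \<phi>(1)
  define w where "w j = 2 powr (real (Suc j) * p)" for j
  have w: "0 \<le> w j" for j by (simp add: w_def)
  have pointwise: "ennreal (\<phi> x powr p)
      \<le> 1 + (\<Sum>j. ennreal (w j) * indicator (suplevel \<phi> (2 ^ j)) x)" for x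
  proof (cases "\<phi> x < 1")
    case True
    then have "\<phi> x powr p \<le> 1" using \<phi>(2)[of x] p by (intro powr_le1) auto
    then have "ennreal (\<phi> x powr p) \<le> 1" by simp
    also have "\<dots> \<le> 1 + (\<Sum>j. ennreal (w j) * indicator (suplevel \<phi> (2 ^ j)) x)" by simp
    finally show ?thesis .
  next
    case False
    define k where "k = nat \<lfloor>\<phi> x\<rfloor>"
    have k: "real k \<le> \<phi> x" "\<phi> x < real k + 1" "1 \<le> k" using False by (auto simp: k_def) linarith+
    obtain j where j: "2 ^ j \<le> k" "k < 2 ^ (j + 1)"
      using ex_power_ivl1[of 2 k] k(3) by auto
    have "\<phi> x \<le> real (k + 1)" using k by simp
    also have "\<dots> \<le> real (2 ^ (j + 1))" using j(2) by (intro of_nat_mono) simp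
    also have "\<dots> = 2 powr real (Suc j)" by (subst powr_realpow) auto
    finally have "\<phi> x powr p \<le> (2 powr real (Suc j)) powr p"
      using \<phi>(2)[of x] p by (intro powr_mono2) auto
    then have "ennreal (\<phi> x powr p) \<le> ennreal (w j)" by (simp add: w_def powr_powr)
    also have "\<dots> = (\<Sum>j\<in>{j}. ennreal (w j) * indicator (suplevel \<phi> (2 ^ j)) x)"
    proof -
      have "real (2 ^ j) \<le> \<phi> x" using of_nat_mono[OF j(1), where 'a=real] k(1) by linarith
      then show ?thesis by (simp add: suplevel_def)
    qed
    also have "\<dots> \<le> (\<Sum>j. ennreal (w j) * indicator (suplevel \<phi> (2 ^ j)) x)"
      by (rule sum_le_suminf) auto
    also have "\<dots> \<le> 1 + \<dots>" by simp
    finally show ?thesis .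
  qed
  define s where "s = (p + \<alpha>) / 2"
  have s: "p < s" "s < \<alpha>" using p by (auto simp: s_def)
  have lim2: "filterlim (\<lambda>j. 2 ^ j :: nat) at_top sequentially"
    by (rule filterlim_subseq) (simp add: strict_mono_def)
  have small: "\<forall>\<^sub>F j in sequentially. norm (w j * ?\<mu> (2 ^ j)) \<le> 2 powr p * (2 powr (p - s)) ^ j"
    using eventually_compose_filterlim[OF eventually_measure_suplevel_less[OF pos lim s(2)] lim2]
  proof eventually_elim
    case (elim j)
    have "norm (w j * ?\<mu> (2 ^ j)) = w j * ?\<mu> (2 ^ j)" using w by simp
    also have "\<dots> \<le> w j * real (2 ^ j) powr - s" using elim w by (intro mult_left_mono) auto
    also have "real (2 ^ j) = 2 powr real j" by (simp add: powr_realpow)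
    also have "w j * (2 powr real j) powr - s = 2 powr (p + (p - s) * real j)"
      unfolding w_def powr_powr powr_add[symmetric] by (simp add: algebra_simps)
    also have "\<dots> = 2 powr p * (2 powr (p - s)) ^ j"
      by (simp add: powr_add powr_powr[symmetric] powr_realpow)
    finally show ?case .
  qed
  have summ: "summable (\<lambda>j. w j * ?\<mu> (2 ^ j))"
  proof (rule summable_comparison_test_ev[OF small])
    have "2 powr (p - s) < (1::real)" using s powr_less_mono[of "p - s" 0 2] by simp
    then show "summable (\<lambda>j. 2 powr p * (2 powr (p - s)) ^ j)"
      by (intro summable_mult summable_geometric) auto
  qed
  have "(\<integral>\<^sup>+x. ennreal (\<phi> x powr p) \<partial>M)
      \<le> (\<integral>\<^sup>+x. 1 + (\<Sum>j. ennreal (w j) * indicator (suplevel \<phi> (2 ^ j)) x) \<partial>M)"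
    by (intro nn_integral_mono pointwise)
  also have "\<dots> = 1 + (\<Sum>j. ennreal (w j) * emeasure M (suplevel \<phi> (2 ^ j)))"
    by (simp add: nn_integral_add nn_integral_suminf nn_integral_cmult emeasure_space_1)
  also have "(\<Sum>j. ennreal (w j) * emeasure M (suplevel \<phi> (2 ^ j)))
      = (\<Sum>j. ennreal (w j * ?\<mu> (2 ^ j)))"
    by (simp add: emeasure_eq_measure ennreal_mult w)
  also have "\<dots> = ennreal (\<Sum>j. w j * ?\<mu> (2 ^ j))"
    using w summ by (intro suminf_ennreal2) auto
  also have "1 + \<dots> < \<infinity>" by simp
  finally show ?thesis .
qed

text \<open>For \<open>t < p < \<alpha>\<close>, the sum \<open>W\<close> of the \<open>p\<close>-th powers up to time \<open>2\<^sup>j\<^sup>+\<^sup>1\<close> has mean of order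
  \<open>2\<^sup>j\<close>, so it exceeds \<open>2\<^sup>j\<^sup>p\<^sup>/\<^sup>t\<close> only with geometrically small probability.\<close>
theorem AE_eventually_birkhoff_sum_le:
  fixes M :: "'a::metric_space measure"
  assumes mps: "measure_preserving_system M f" and sets: "sets M = sets borel"
    and \<phi>: "\<phi> \<in> borel_measurable M" "\<And>x. 0 \<le> \<phi> x"
    and pos: "\<And>n. 0 < measure M (suplevel \<phi> n)"
    and lim: "(\<lambda>n. ln (measure M (suplevel \<phi> n)) / (- ln (real n))) \<longlonglongrightarrow> \<alpha>"
    and t: "0 < t" "t < \<alpha>" and \<alpha>: "\<alpha> \<le> 1"
  shows "AE x in M. \<forall>\<^sub>F n in sequentially. birkhoff_sum f \<phi> n x \<le> real n powr (1 / t)"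
proof -
  interpret measure_preserving_system M f by fact
  note [measurable] = \<phi>(1)
  define p where "p = (t + \<alpha>) / 2"
  have p: "t < p" "0 < p" "p < \<alpha>" "p \<le> 1" using t \<alpha> by (auto simp: p_def)
  define I where "I = (\<integral>x. \<phi> x powr p \<partial>M)"
  have int: "integrable M (\<lambda>x. \<phi> x powr p)"
    using powr_moment_finite[OF prob_space_axioms sets \<phi> pos lim p(2,3)]
    by (intro integrableI_nonneg) auto
  have intk: "integrable M (\<lambda>x. \<phi> ((f ^^ k) x) powr p)" for k
    using integrable_distr_eq[of "f ^^ k" M M "\<lambda>x. \<phi> x powr p"] int by (simp add: distr_funpow)
  define W where "W n x = (\<Sum>k<n. \<phi> ((f ^^ k) x) powr p)" for n x
  have intW: "integrable M (W n)" for n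
    unfolding W_def[abs_def] by (intro Bochner_Integration.integrable_sum intk)
  have EW: "(\<integral>x. W n x \<partial>M) = real n * I" for n
    unfolding W_def using intk integral_funpow[of "\<lambda>x. \<phi> x powr p"]
    by (simp add: Bochner_Integration.integral_sum I_def)
  have W0: "0 \<le> W n x" for n x unfolding W_def by (intro sum_nonneg) simp
  have SW: "birkhoff_sum f \<phi> n x powr p \<le> W n x" for n x
    unfolding birkhoff_sum_def W_def using \<phi>(2) p by (intro powr_sum_le) auto
  (* The threshold is tied to the start of the dyadic block, where n powr (p / t) is smallest, and
     W in bad j to its end, where W is largest. *)
  define h where "h j = 2 powr (real j * (p / t))" for j
  define bad where "bad j = {x \<in> space M. W (2 ^ Suc j) x \<ge> h j}" for j
  have bad_sets: "bad j \<in> sets M" for j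
    unfolding bad_def using borel_measurable_integrable[OF intW] by measurable
  define \<rho> where "\<rho> = 2 powr (1 - p / t)"
  have \<rho>: "0 < \<rho>" "\<rho> < 1" using p t powr_less_mono[of "1 - p / t" 0 2] by (auto simp: \<rho>_def)
  have small: "prob (bad j) \<le> 2 * I * \<rho> ^ j" for j
  proof -
    have "prob (bad j) \<le> (\<integral>x. W (2 ^ Suc j) x \<partial>M) / h j"
      unfolding bad_def
      by (rule integral_Markov_inequality_measure[where A="{}"])
         (use intW W0 in \<open>auto simp: h_def\<close>)
    also have "\<dots> = 2 * I * (2 powr real j / 2 powr (real j * (p / t)))"
      by (simp add: EW h_def powr_realpow)
    also have "2 powr real j / 2 powr (real j * (p / t)) = 2 powr ((1 - p / t) * real j)"
      unfolding powr_diff[symmetric] by (simp add: algebra_simps)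
    also have "\<dots> = \<rho> ^ j"
      by (simp add: \<rho>_def powr_powr[symmetric] powr_realpow)
    finally show ?thesis .
  qed
  have "summable (\<lambda>j. prob (bad j))"
  proof (rule summable_comparison_test')
    show "norm (prob (bad j)) \<le> 2 * I * \<rho> ^ j" for j using small by simp
    show "summable (\<lambda>j. 2 * I * \<rho> ^ j)"
      using \<rho> by (intro summable_mult summable_geometric) auto
  qed
  then have "AE x in M. \<forall>\<^sub>F j in sequentially. x \<in> space M - bad j"
    using bad_sets by (intro borel_cantelli_AE1) (auto simp: emeasure_eq_measure)
  then show ?thesis
  proof eventually_elim
    case (elim x)
    then show ?case
    proof (rule eventually_dyadic)
      fix j n :: nat
      assume x: "x \<in> space M - bad j" and n: "2 ^ j \<le> n" "n \<le> 2 ^ Suc j"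
      let ?S = "birkhoff_sum f \<phi> n x"
      have S0: "0 \<le> ?S" unfolding birkhoff_sum_def using \<phi>(2) by (intro sum_nonneg) auto
      have "?S powr p \<le> W n x" by (rule SW)
      also have "\<dots> \<le> W (2 ^ Suc j) x"
        unfolding W_def using n(2) by (intro sum_mono2) auto
      also have "\<dots> \<le> h j" using x by (auto simp: bad_def)
      also have "\<dots> = (2 powr real j) powr (p / t)" by (simp add: h_def powr_powr)
      also have "\<dots> \<le> real n powr (p / t)"
        using of_nat_mono[OF n(1), where 'a=real] p t
        by (intro powr_mono2) (auto simp: powr_realpow)
      finally have "(?S powr p) powr (1 / p) \<le> (real n powr (p / t)) powr (1 / p)"
        using p by (intro powr_mono2) auto
      then show "?S \<le> real n powr (1 / t)" using p S0 by (simp add: powr_powr)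
    qed
  qed
qed

section \<open>The logarithm laws\<close>

text \<open>Otherwise the first moment would be among the finite ones.\<close>
lemma exponent_le_1:
  assumes "prob_space M" "sets M = sets borel"
    and \<phi>: "\<phi> \<in> borel_measurable M" "\<And>x. 0 \<le> \<phi> x"
    and pos: "\<And>n. 0 < measure M (suplevel \<phi> n)"
    and lim: "(\<lambda>n. ln (measure M (suplevel \<phi> n)) / (- ln (real n))) \<longlonglongrightarrow> \<alpha>"
    and inf: "(\<integral>\<^sup>+x. ennreal (\<phi> x) \<partial>M) = \<infinity>"
  shows "\<alpha> \<le> 1"
proof (rule ccontr)
  assume "\<not> \<alpha> \<le> 1"
  then have "(\<integral>\<^sup>+x. ennreal (\<phi> x powr 1) \<partial>M) < \<infinity>"
    by (intro powr_moment_finite[OF assms(1-6)]) auto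
  then show False using inf \<phi>(2) by simp
qed

text \<open>The exponent \<open>Suc i\<close> is written \<open>1 / \<gamma>\<close> with \<open>\<gamma> = 1 / Suc i\<close>, the form in which the lower
  bound on the maximum supplies it; countably many \<open>\<gamma>\<close> suffice.\<close>
lemma filterlim_ln_ratio_at_top:
  fixes a :: "nat \<Rightarrow> real"
  assumes a: "\<And>i::nat. \<forall>\<^sub>F n in sequentially. real n powr (1 / (1 / real (Suc i))) \<le> a n"
  shows "filterlim (\<lambda>n. ln (a n) / ln (real n)) at_top sequentially"
  unfolding filterlim_at_top
proof
  fix Z :: real
  obtain i :: nat where i: "Z \<le> real i" using real_arch_simple by blast
  show "\<forall>\<^sub>F n in sequentially. Z \<le> ln (a n) / ln (real n)"
    using a[of i] eventually_gt_at_top[of 1]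
  proof eventually_elim
    case (elim n)
    have "0 < real n powr (1 / (1 / real (Suc i)))" using elim by simp
    then have "0 < a n" using elim by linarith
    then have "ln (real n powr real (Suc i)) \<le> ln (a n)" using elim by (subst ln_le_cancel_iff) auto
    then have "real (Suc i) * ln (real n) \<le> ln (a n)" by (simp add: ln_powr)
    then have "real (Suc i) \<le> ln (a n) / ln (real n)" using elim by (subst pos_le_divide_eq) auto
    then show ?case using i by simp
  qed
qed

theorem theorem2p5:
  fixes M :: "'a::metric_space measure" and f :: "'a \<Rightarrow> 'a"
    and \<phi> :: "'a \<Rightarrow> real" and \<alpha> :: real
  assumes "prob_space M" and "sets M = sets borel"
    and "measure_preserving_map M f"
    and "SPDC M f"
    and "\<phi> \<in> borel_measurable M"
    and "\<And>x. \<phi> x \<ge> 0" and "\<not> bounded (range \<phi>)"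
    and "regular_suplevels M \<phi>"
    and "\<alpha> = suplevel_exponent M \<phi>"
    and "(\<integral>\<^sup>+ x. ennreal (\<phi> x) \<partial>M) = \<infinity>"
  shows "(\<alpha> > 0 \<longrightarrow> (\<forall>\<epsilon>. 0 < \<epsilon> \<and> \<epsilon> < \<alpha> \<longrightarrow>
            (AE x in M. \<exists>N::nat. \<forall>n\<ge>N.
               real n powr (1 / (\<alpha> + \<epsilon>)) \<le> birkhoff_max f \<phi> n x \<and>
               birkhoff_max f \<phi> n x < birkhoff_sum f \<phi> n x \<and>
               birkhoff_sum f \<phi> n x \<le> real n powr (1 / (\<alpha> - \<epsilon>)))))
       \<and> (\<alpha> = 0 \<longrightarrow>
            (AE x in M.
               filterlim (\<lambda>n. ln (birkhoff_sum f \<phi> n x) / ln (real n)) at_top sequentially \<and>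
               filterlim (\<lambda>n. ln (birkhoff_max f \<phi> n x) / ln (real n)) at_top sequentially))"
proof -
  have mps: "measure_preserving_system M f"
    using assms(1,3) by (simp add: measure_preserving_system_def measure_preserving_system_axioms_def)
  obtain \<alpha>' where \<alpha>': "0 \<le> \<alpha>'"
      "(\<lambda>n. ln (measure M (suplevel \<phi> n)) / (- ln (real n))) \<longlonglongrightarrow> \<alpha>'"
    using assms(8) unfolding regular_suplevels_def by blast
  then have "\<alpha> = \<alpha>'" using assms(9) unfolding suplevel_exponent_def by (simp only: limI)
  then have \<alpha>: "0 \<le> \<alpha>" and lim: "(\<lambda>n. ln (measure M (suplevel \<phi> n)) / (- ln (real n))) \<longlonglongrightarrow> \<alpha>"
    using \<alpha>' by simp_all
  note pos = measure_suplevel_pos[OF assms(1,2,5,8)]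
  have \<alpha>1: "\<alpha> \<le> 1" by (rule exponent_le_1[OF assms(1,2,5,6) pos lim assms(10)])
  note lower = AE_eventually_birkhoff_max_ge[OF mps assms(2,4,5,8) lim \<alpha>]
  show ?thesis
  proof (intro conjI impI allI)
    fix \<epsilon> assume \<epsilon>: "0 < \<epsilon> \<and> \<epsilon> < \<alpha>"
    have "AE x in M. \<forall>\<^sub>F n in sequentially. real n powr (1 / (\<alpha> + \<epsilon>)) \<le> birkhoff_max f \<phi> n x"
      using \<epsilon> by (intro lower) simp
    moreover have "AE x in M. \<forall>\<^sub>F n in sequentially. birkhoff_sum f \<phi> n x \<le> real n powr (1 / (\<alpha> - \<epsilon>))"
      using \<epsilon> by (intro AE_eventually_birkhoff_sum_le[OF mps assms(2,5,6) pos lim _ _ \<alpha>1]) auto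
    ultimately show "AE x in M. \<exists>N::nat. \<forall>n\<ge>N.
               real n powr (1 / (\<alpha> + \<epsilon>)) \<le> birkhoff_max f \<phi> n x \<and>
               birkhoff_max f \<phi> n x < birkhoff_sum f \<phi> n x \<and>
               birkhoff_sum f \<phi> n x \<le> real n powr (1 / (\<alpha> - \<epsilon>))"
    proof eventually_elim
      case (elim x)
      have "\<forall>\<^sub>F n in sequentially. birkhoff_max f \<phi> n x < birkhoff_sum f \<phi> n x"
        using \<epsilon> by (intro eventually_birkhoff_max_less_sum[OF assms(6) _ elim(1)]) simp
      then show ?case
        unfolding eventually_sequentially[symmetric] using elim by (intro eventually_conj)
    qed
  next
    assume "\<alpha> = 0"
    then have "AE x in M. \<forall>i. \<forall>\<^sub>F n in sequentially.
        real n powr (1 / (1 / real (Suc i))) \<le> birkhoff_max f \<phi> n x"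
      unfolding AE_all_countable by (intro allI lower) simp
    then show "AE x in M.
               filterlim (\<lambda>n. ln (birkhoff_sum f \<phi> n x) / ln (real n)) at_top sequentially \<and>
               filterlim (\<lambda>n. ln (birkhoff_max f \<phi> n x) / ln (real n)) at_top sequentially"
    proof eventually_elim
      case (elim x)
      have "\<forall>\<^sub>F n in sequentially.
          real n powr (1 / (1 / real (Suc i))) \<le> birkhoff_sum f \<phi> n x" for i
        using elim[rule_format, of i] eventually_gt_at_top[of 0]
      proof eventually_elim
        case (elim n)
        then show ?case using birkhoff_max_le_sum[of \<phi> n f x] assms(6) by (meson order_trans)
      qed
      then show ?case using elim by (intro conjI filterlim_ln_ratio_at_top) auto
    qed
  qed
qed

end
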